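(* For every $q\in[1,2]$ and every $\varepsilon\in(0,1)$ there is a constant $c(q,\varepsilon)>0$, depending only on $q$ and $\varepsilon$, such that the following holds. Let $1\le p_1,p_2\le\infty$, $s,b\in\mathbb N$ and $N=sb$. Then for every integer $n\ge 0$ with $n\le N(1-\varepsilon)$, $$c(q,\varepsilon)\,s^{\left(\frac1q-\frac1{p_1}\right)_+}b^{\left(\frac1q-\frac1{p_2}\right)_+}\ \le\ d_n(B_{p_1,p_2}^{s,b},\ell_q^N)\ \le\ s^{\left(\frac1q-\frac1{p_1}\right)_+}b^{\left(\frac1q-\frac1{p_2}\right)_+}.$$
   Context: $t_+=\max(t,0)$ and $1/\infty=0$. For $1\le p_1,p_2\le\infty$ and $N=sb$, $B_{p_1,p_2}^{s,b}$ is the unit ball of $\mathbb R^N$ in the mixed norm $\|x\|_{p_1,p_2}=\Big(\sum_{j=1}^b\big(\sum_{s(j-1)<i\le sj}|x_i|^{p_1}\big)^{p_2/p_1}\Big)^{1/p_2}$, with the usual modification (maxima) for $p_1=\infty$ or $p_2=\infty$. $\ell_q^N$ is $\mathbb R^N$ with the norm $\|x\|_q=(\sum_{k=1}^N|x_k|^q)^{1/q}$. The Kolmogorov width of a subset $K$ of a normed space $X$ is $d_n(K,X)=\inf_{Q_n}\sup_{x\in K}\inf_{y\in Q_n}\|x-y\|_X$, the outer infimum over all linear subspaces $Q_n\subset X$ of dimension at most $n$. *)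

theory Defs
  imports "HOL-Analysis.Analysis" "HOL-Library.Function_Algebras"
begin

text \<open>
  Since the dimension \<open>N\<close> has to vary below a uniform constant, \<open>\<real>\<^sup>N\<close> is the set of real sequences
  vanishing outside \<open>{1..N}\<close>. Addition of sequences is that of \<^theory>\<open>HOL-Library.Function_Algebras\<close>.
\<close>

definition scale_seq :: "real \<Rightarrow> (nat \<Rightarrow> real) \<Rightarrow> (nat \<Rightarrow> real)" where
  "scale_seq c x = (\<lambda>i. c * x i)"

global_interpretation seq: vector_space scale_seq
  by unfold_locales (auto simp: scale_seq_def fun_eq_iff algebra_simps)

definition coord_space :: "nat \<Rightarrow> (nat \<Rightarrow> real) set" where
  "coord_space N = {x. \<forall>i. i \<notin> {1..N} \<longrightarrow> x i = 0}"

definition lp_norm :: "ennreal \<Rightarrow> nat set \<Rightarrow> (nat \<Rightarrow> real) \<Rightarrow> real" where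
  "lp_norm p I x =
     (if p = \<infinity> then Max ((\<lambda>i. \<bar>x i\<bar>) ` I)
      else (\<Sum>i\<in>I. \<bar>x i\<bar> powr enn2real p) powr (1 / enn2real p))"

definition mixed_norm :: "nat \<Rightarrow> nat \<Rightarrow> ennreal \<Rightarrow> ennreal \<Rightarrow> (nat \<Rightarrow> real) \<Rightarrow> real" where
  "mixed_norm s b p1 p2 x = lp_norm p2 {1..b} (\<lambda>j. lp_norm p1 {s * (j - 1)<..s * j} x)"

definition mixed_ball :: "nat \<Rightarrow> nat \<Rightarrow> ennreal \<Rightarrow> ennreal \<Rightarrow> (nat \<Rightarrow> real) set" where
  "mixed_ball s b p1 p2 = {x \<in> coord_space (s * b). mixed_norm s b p1 p2 x \<le> 1}"

text \<open>
  The width of \<open>K\<close> in the space \<open>V\<close> normed by \<open>nrm\<close>, with values in \<open>[0, \<infinity>]\<close> so that all infima and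
  suprema exist. The finite spanning set is required because \<^const>\<open>seq.dim\<close> is \<open>0\<close> on
  infinite-dimensional subspaces.
\<close>

definition kolmogorov_width ::
  "nat \<Rightarrow> (nat \<Rightarrow> real) set \<Rightarrow> (nat \<Rightarrow> real) set \<Rightarrow> ((nat \<Rightarrow> real) \<Rightarrow> real) \<Rightarrow> ennreal" where
  "kolmogorov_width n K V nrm =
     (INF Q \<in> {Q. seq.subspace Q \<and> Q \<subseteq> V \<and> (\<exists>B. finite B \<and> Q \<subseteq> seq.span B) \<and> seq.dim Q \<le> n}.
        SUP x\<in>K. INF y\<in>Q. ennreal (nrm (x - y)))"

definition recip :: "ennreal \<Rightarrow> real" where
  "recip p = enn2real (1 / p)"

lemma recip_infinity: "recip \<infinity> = 0"
  by (simp add: recip_def)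

end

theory Submission
  imports Defs
begin

text \<open>
  The upper bound is Hoelder's inequality, applied inside the blocks and then across them: the zero
  subspace already attains it (\<open>kolmogorov_width_mixed_ball_le\<close>).

  For the lower bound fix an approximating space \<open>Q\<close> of dimension at most \<open>n\<close>. Put \<open>k\<^sub>1 = s\<close> if
  \<open>1/p\<^sub>1 < 1/q\<close> and \<open>k\<^sub>1 = 1\<close> otherwise, and define \<open>k\<^sub>2\<close> from \<open>b\<close> and \<open>p\<^sub>2\<close> in the same way. These numbers
  decide whether the extremal vectors are spread over a whole block or sit on one coordinate of it, and
  whether they use all blocks or one. Accordingly the coordinates split into \<open>N / (k\<^sub>1 k\<^sub>2)\<close> cells of
  \<open>k\<^sub>1 k\<^sub>2\<close> coordinates: everything; the coordinates with a fixed position inside their blocks; one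
  block; or one coordinate. A vector with entries in \<open>[-1, 1]\<close> supported on a cell has mixed norm at most
  \<open>k\<^sub>1\<close> to the power \<open>1/p\<^sub>1\<close> times \<open>k\<^sub>2\<close> to the power \<open>1/p\<^sub>2\<close>, (\<open>mixed_norm_cell_le_1\<close>), so all four regimes
  follow once some cell carries such a vector whose \<open>\<ell>\<^sub>q\<close> distance to \<open>Q\<close> has \<open>q\<close>-th power at least a
  constant times \<open>k\<^sub>1 k\<^sub>2\<close>.

  Such a cell is found by averaging. There are coordinate weights \<open>w\<close> of total mass at least
  \<open>N - n \<ge> \<epsilon> N\<close> such that every set \<open>D\<close> of coordinates carries a vector \<open>u\<close>, with entries in
  \<open>[-1, 1]\<close>, at distance (to the power \<open>q\<close>) at least \<open>c w(D)\<close> from \<open>Q\<close>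
  (\<open>exists_distance_weight\<close>); some cell then has weight at
  least \<open>\<epsilon> k\<^sub>1 k\<^sub>2\<close>. The distances are bounded below by duality, testing \<open>u\<close> against a vector \<open>z\<close> in the
  annihilator of \<open>Q\<close>, and \<open>z\<close> is chosen in one of two ways.

  If \<open>q > 1\<close>, the weights are the diagonal of the orthogonal projection \<open>P\<close> onto the annihilator, whose
  trace is the dimension of the annihilator; \<open>u\<close> is a choice of signs on \<open>D\<close> and \<open>z = P u\<close>. For random signs
  the mean of \<open>\<langle>u, z\<rangle>\<close> is \<open>w(D)\<close>. With \<open>r\<close> the conjugate exponent, \<open>\<bar>t\<bar>\<close> to the power \<open>r\<close> is at most a
  multiple of \<open>cosh t - 1\<close>, and the mean of \<open>cosh z\<^sub>i - 1\<close> is of the order of the variance of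
  \<open>z\<^sub>i\<close> (\<open>sum_signs_cosh_le\<close>); as these variances add up to \<open>w(D)\<close> again, nothing is lost in comparison with \<open>q = 2\<close>.

  If \<open>q = 1\<close>, the maximum of the entries of \<open>P u\<close> is not under control. Instead, \<open>z\<close> is a vertex of the
  section of the cube by the annihilator (\<open>exists_vertex_of_cube_section\<close>): at least \<open>N - n\<close> of its entries are \<open>1\<close> or \<open>-1\<close>, the weights
  count these entries, and \<open>u\<close> is the sign pattern of \<open>z\<close> on \<open>D\<close>.
\<close>

section \<open>Projections onto annihilators\<close>

text \<open>
  The condition \<open>P P\<^sup>T = P\<close> makes \<open>P\<close> symmetric and idempotent, hence an orthogonal projection. In this form
  it also says that the squares in row \<open>i\<close> add up to the diagonal entry \<open>P i i\<close>.
  The range of \<open>P\<close> lies in the annihilator of \<open>B\<close>; how much of it is reached is measured by the trace.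
\<close>
definition annihilator_projection :: "'a set \<Rightarrow> ('a \<Rightarrow> real) set \<Rightarrow> ('a \<Rightarrow> 'a \<Rightarrow> real) \<Rightarrow> bool" where
  "annihilator_projection I B P \<longleftrightarrow>
     (\<forall>i\<in>I. \<forall>j\<in>I. (\<Sum>k\<in>I. P i k * P j k) = P i j) \<and> (\<forall>v\<in>B. \<forall>i\<in>I. (\<Sum>k\<in>I. P i k * v k) = 0)"

text \<open>
  The trace of a projection is its rank, so the trace bound is the dimension count for the annihilator.
  The vectors of \<open>B\<close> are projected away one at a time by rank-one corrections, each of which lowers the
  trace by at most one; no basis has to be chosen.
\<close>
lemma exists_annihilator_projection:
  fixes I :: "'a set" and B :: "('a \<Rightarrow> real) set"
  assumes I: "finite I" and B: "finite B"
  obtains P where "annihilator_projection I B P" and "real (card I) - real (card B) \<le> (\<Sum>i\<in>I. P i i)"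
proof -
  define good where "good C P \<longleftrightarrow>
      annihilator_projection I C P \<and> real (card I) - real (card C) \<le> (\<Sum>i\<in>I. P i i)"
    for C :: "('a \<Rightarrow> real) set" and P
  note defs = good_def annihilator_projection_def
  have "\<exists>P. good B P"
    using B
  proof (induction B rule: finite_induct)
    case empty
    show ?case
      unfolding defs
    proof (intro exI[of _ "\<lambda>i j. if i = j then 1 else 0"] conjI ballI allI)
      show "(\<Sum>k\<in>I. (if i = k then 1 else 0) * (if j = k then 1 else 0)) = (if i = j then 1 else (0::real))"
        if "i \<in> I" for i j
      proof -
        have "(\<Sum>k\<in>I. (if i = k then 1 else 0) * (if j = k then 1 else 0))
          = (\<Sum>k\<in>I. if k = i then (if i = j then 1 else (0::real)) else 0)"
          by (rule sum.cong) auto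
        then show ?thesis using that I by simp
      qed
    qed auto
  next
    case (insert v B)
    then obtain P where P: "good B P" by blast
    have idem: "(\<Sum>k\<in>I. P i k * P j k) = P i j" if "i \<in> I" "j \<in> I" for i j
      using P that by (simp add: defs)
    have sym: "P i j = P j i" if "i \<in> I" "j \<in> I" for i j
      using idem[OF that] idem[OF that(2,1)] by (simp add: mult.commute)
    have kill: "(\<Sum>k\<in>I. P i k * w k) = 0" if "w \<in> B" "i \<in> I" for w i
      using P that by (simp add: defs)
    have tr: "real (card I) - real (card B) \<le> (\<Sum>i\<in>I. P i i)"
      using P by (simp add: defs)
    define u where "u i = (\<Sum>k\<in>I. P i k * v k)" for i
    define c where "c = (\<Sum>i\<in>I. u i * u i)"
    have swap: "(\<Sum>k\<in>I. u k * w k) = (\<Sum>l\<in>I. v l * (\<Sum>k\<in>I. P l k * w k))" for w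
    proof -
      have "(\<Sum>k\<in>I. u k * w k) = (\<Sum>k\<in>I. \<Sum>l\<in>I. P k l * v l * w k)"
        unfolding u_def by (simp add: sum_distrib_right)
      also have "\<dots> = (\<Sum>l\<in>I. \<Sum>k\<in>I. P k l * v l * w k)"
        by (rule sum.swap)
      also have "\<dots> = (\<Sum>l\<in>I. v l * (\<Sum>k\<in>I. P l k * w k))"
        unfolding sum_distrib_left by (intro sum.cong refl) (simp add: sym mult_ac)
      finally show ?thesis .
    qed
    have Pu: "(\<Sum>k\<in>I. u k * P i k) = u i" if "i \<in> I" for i
    proof -
      have "(\<Sum>k\<in>I. u k * P i k) = (\<Sum>l\<in>I. v l * P l i)"
        unfolding swap using idem that by simp
      also have "\<dots> = u i"
        unfolding u_def using that by (intro sum.cong refl) (simp add: sym mult_ac)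
      finally show ?thesis .
    qed
    have uv: "(\<Sum>k\<in>I. u k * v k) = c"
    proof -
      have "c = (\<Sum>l\<in>I. v l * u l)"
        unfolding c_def swap using Pu by (simp add: mult.commute)
      then show ?thesis by (simp add: mult.commute)
    qed
    have uw: "(\<Sum>k\<in>I. u k * w k) = 0" if "w \<in> B" for w
      unfolding swap using kill[OF that] by simp
    show ?case
    proof (cases "c = 0")
      case True
      then have "\<forall>i\<in>I. u i = 0"
        unfolding c_def using I by (subst (asm) sum_nonneg_eq_0_iff) auto
      moreover have "card B \<le> card (insert v B)"
        using insert.hyps by simp
      ultimately have "good (insert v B) P"
        unfolding defs using idem kill tr by (intro conjI allI ballI) (auto simp flip: u_def)
      then show ?thesis by blast
    next
      case False
      \<comment> \<open>\<open>u\<close> is the part of \<open>v\<close> that \<open>P\<close> does not annihilate yet, and \<open>c\<close> its squared length.\<close>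
      define P' where "P' i j = P i j - u i * u j / c" for i j
      have lin: "(\<Sum>k\<in>I. P' i k * w k) = (\<Sum>k\<in>I. P i k * w k) - u i * (\<Sum>k\<in>I. u k * w k) / c"
        for i w
        unfolding P'_def
        by (simp add: left_diff_distrib sum_subtractf sum_distrib_left sum_divide_distrib mult.assoc)
      show ?thesis
        unfolding defs
      proof (intro exI[of _ P'] conjI ballI allI)
        show "(\<Sum>k\<in>I. P' i k * P' j k) = P' i j" if "i \<in> I" "j \<in> I" for i j
        proof -
          have *: "(\<Sum>k\<in>I. x k * P' j k) = (\<Sum>k\<in>I. x k * P j k) - u j * (\<Sum>k\<in>I. x k * u k) / c" for x
            using lin[of j x] by (simp add: mult.commute)
          have "(\<Sum>k\<in>I. P i k * u k) = u i"
            using Pu[OF that(1)] by (simp add: mult.commute)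
          then have "(\<Sum>k\<in>I. P' i k * P' j k) = P i j - u j * u i / c - u i * (u j - u j * c / c) / c"
            unfolding lin * by (simp only: idem[OF that] Pu[OF that(2)] c_def[symmetric])
          then show ?thesis using False by (simp add: P'_def)
        qed
        show "(\<Sum>k\<in>I. P' i k * w k) = 0" if "w \<in> insert v B" "i \<in> I" for w i
          using that False unfolding lin by (auto simp: uv uw kill simp flip: u_def)
        show "real (card I) - real (card (insert v B)) \<le> (\<Sum>i\<in>I. P' i i)"
          using tr insert.hyps False
          by (simp add: P'_def sum_subtractf flip: c_def sum_divide_distrib)
      qed
    qed
  qed
  then show ?thesis
    using that unfolding good_def by blast
qed

section \<open>Vertices of sections of the cube\<close>

text \<open>
  Take a point of the section with as many entries of absolute value one as possible. If fewer than
  \<open>card I - card B\<close> entries were tight in this sense, a nonzero vector would annihilate \<open>B\<close> and vanish at all tight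
  entries, and moving along it would keep these tight until a further one becomes so.
\<close>
lemma exists_vertex_of_cube_section:
  fixes I :: "'a set" and B :: "('a \<Rightarrow> real) set"
  assumes I: "finite I" and B: "finite B"
  obtains z where "\<And>i. i \<in> I \<Longrightarrow> \<bar>z i\<bar> \<le> 1" and "\<And>v. v \<in> B \<Longrightarrow> (\<Sum>i\<in>I. z i * v i) = 0"
    and "card I \<le> card {i\<in>I. \<bar>z i\<bar> = 1} + card B"
proof -
  define feas where "feas z \<longleftrightarrow> (\<forall>i\<in>I. \<bar>z i\<bar> \<le> 1) \<and> (\<forall>v\<in>B. (\<Sum>i\<in>I. z i * v i) = 0)"
    for z :: "'a \<Rightarrow> real"
  define tight where "tight z = {i\<in>I. \<bar>z i\<bar> = 1}" for z :: "'a \<Rightarrow> real"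
  have "feas (\<lambda>_. 0)" by (simp add: feas_def)
  moreover have "\<forall>z. feas z \<longrightarrow> card (tight z) < Suc (card I)"
    using I by (auto simp: tight_def less_Suc_eq_le intro!: card_mono)
  ultimately obtain z where z: "feas z" and max: "\<And>y. feas y \<Longrightarrow> card (tight y) \<le> card (tight z)"
    using ex_has_greatest_nat[of feas _ "\<lambda>z. card (tight z)" "Suc (card I)"] by blast
  have "card I \<le> card (tight z) + card B"
  proof (rule ccontr)
    assume few: "\<not> ?thesis"
    \<comment> \<open>Adding the unit vectors of the tight entries to \<open>B\<close> forces the direction to vanish there.\<close>
    define E where "E = (\<lambda>i k. if k = i then 1 else (0::real)) ` tight z"
    have fin: "finite (tight z)" using I by (simp add: tight_def)
    have "finite (B \<union> E)" using B fin by (simp add: E_def)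
    then obtain P where P: "annihilator_projection I (B \<union> E) P"
      and tr: "real (card I) - real (card (B \<union> E)) \<le> (\<Sum>i\<in>I. P i i)"
      by (rule exists_annihilator_projection[OF I])
    have "card (B \<union> E) \<le> card B + card E" by (rule card_Un_le)
    also have "card E \<le> card (tight z)" unfolding E_def using fin by (rule card_image_le)
    finally have "0 < (\<Sum>i\<in>I. P i i)" using few tr by linarith
    then have "\<not> (\<forall>i\<in>I. P i i = 0)" by (intro notI) simp
    then obtain m where m: "m \<in> I" "P m m \<noteq> 0" by blast
    define w where "w = P m"
    have wB: "(\<Sum>k\<in>I. w k * v k) = 0" if "v \<in> B" for v
      using P m that by (simp add: w_def annihilator_projection_def)
    have wT: "w i = 0" if "i \<in> tight z" for i
    proof -
      have "(\<Sum>k\<in>I. w k * (if k = i then 1 else 0)) = 0"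
        using P m that unfolding w_def annihilator_projection_def E_def by fast
      then show ?thesis using that I by (simp add: tight_def if_distrib cong: if_cong)
    qed
    define J where "J = {i\<in>I. w i \<noteq> 0}"
    \<comment> \<open>\<open>g i\<close> is the time at which entry \<open>i\<close> reaches the side of the cube that it moves towards.\<close>
    define g where "g i = (1 - sgn (w i) * z i) / \<bar>w i\<bar>" for i
    have J: "finite J" "J \<noteq> {}" using I m by (auto simp: J_def w_def)
    define t where "t = Min (g ` J)"
    have "t \<in> g ` J" unfolding t_def using J by (intro Min_in) auto
    then obtain i0 where i0: "i0 \<in> J" "t = g i0" by auto
    have tle: "t \<le> g i" if "i \<in> J" for i unfolding t_def using J that by (intro Min_le) auto
    have z1: "\<bar>z i\<bar> \<le> 1" if "i \<in> I" for i
      using z that unfolding feas_def by blast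
    have sz: "\<bar>sgn (w i) * z i\<bar> \<le> 1" if "i \<in> I" for i
      using z1[OF that] by (simp add: abs_mult sgn_if)
    have t0: "0 \<le> t" unfolding i0 g_def
      using sz[of i0] i0(1) by (intro divide_nonneg_nonneg) (auto simp: J_def)
    define y where "y i = z i + t * w i" for i
    have ysgn: "\<bar>y i\<bar> = \<bar>sgn (w i) * z i + t * \<bar>w i\<bar>\<bar>" if "i \<in> J" for i
    proof -
      have "sgn (w i) * y i = sgn (w i) * z i + t * \<bar>w i\<bar>"
        unfolding y_def by (simp add: algebra_simps abs_sgn)
      moreover have "\<bar>sgn (w i) * y i\<bar> = \<bar>y i\<bar>"
        using that by (simp add: abs_mult J_def sgn_if)
      ultimately show ?thesis by simp
    qed
    have "\<bar>y i\<bar> \<le> 1" if "i \<in> I" for i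
    proof (cases "i \<in> J")
      case True
      have "t * \<bar>w i\<bar> \<le> 1 - sgn (w i) * z i"
        using tle[OF True] True by (simp add: g_def J_def pos_le_divide_eq)
      moreover have "0 \<le> t * \<bar>w i\<bar>" using t0 by simp
      ultimately show ?thesis using sz[OF that] unfolding ysgn[OF True] by linarith
    next
      case False
      then show ?thesis using that z1 by (simp add: J_def y_def)
    qed
    moreover have "(\<Sum>i\<in>I. y i * v i) = 0" if "v \<in> B" for v
    proof -
      have "(\<Sum>i\<in>I. y i * v i) = (\<Sum>i\<in>I. z i * v i) + t * (\<Sum>i\<in>I. w i * v i)"
        by (simp add: y_def algebra_simps sum.distrib sum_distrib_left)
      also have "(\<Sum>i\<in>I. z i * v i) = 0" using z that unfolding feas_def by blast
      finally show ?thesis using wB[OF that] by simp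
    qed
    ultimately have "feas y" unfolding feas_def by blast
    have "\<bar>y i0\<bar> = 1"
      unfolding ysgn[OF i0(1)] using i0 by (simp add: g_def J_def)
    moreover have "i0 \<notin> tight z" "i0 \<in> I" using wT i0 by (auto simp: J_def)
    ultimately have "insert i0 (tight z) \<subseteq> tight y"
      using wT by (auto simp: tight_def y_def)
    then have "card (insert i0 (tight z)) \<le> card (tight y)"
      using I by (intro card_mono) (auto simp: tight_def)
    then show False using max[OF \<open>feas y\<close>] \<open>i0 \<notin> tight z\<close> fin by simp
  qed
  with z show ?thesis unfolding feas_def tight_def by (intro that[of z]) blast+
qed

section \<open>Moments of random sign sums\<close>
definition signs :: "'a set \<Rightarrow> ('a \<Rightarrow> real) set" where
  "signs D = D \<rightarrow>\<^sub>E {-1, 1}"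

lemma finite_signs: "finite D \<Longrightarrow> finite (signs D)"
  unfolding signs_def by (intro finite_PiE) auto

lemma card_signs: "finite D \<Longrightarrow> card (signs D) = 2 ^ card D"
  unfolding signs_def by (simp add: card_PiE numeral_2_eq_2)

text \<open>
  Independence of the signs: the sum over all sign patterns factors over the coordinates.
\<close>
lemma sum_signs_prod:
  assumes "finite D"
  shows "(\<Sum>\<sigma>\<in>signs D. \<Prod>k\<in>D. f k (\<sigma> k)) = (\<Prod>k\<in>D. f k (-1) + (f k 1 :: real))"
  unfolding signs_def by (subst prod_sum_PiE[symmetric]) (use assms in auto)

lemma sum_signs_mult:
  assumes "finite D" "k \<in> D" "l \<in> D" "k \<noteq> l"
  shows "(\<Sum>\<sigma>\<in>signs D. \<sigma> k * \<sigma> l) = 0"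
proof -
  define f where "f j y = (if j = k then y else 1) * (if j = l then y else (1::real))" for j y
  have "\<sigma> k * \<sigma> l = (\<Prod>j\<in>D. f j (\<sigma> j))" for \<sigma> :: "'a \<Rightarrow> real"
    unfolding f_def using assms by (simp add: prod.distrib prod.delta)
  then have "(\<Sum>\<sigma>\<in>signs D. \<sigma> k * \<sigma> l) = (\<Prod>j\<in>D. f j (-1) + f j 1)"
    by (simp only: sum_signs_prod[OF assms(1)])
  also have "\<dots> = 0"
    using assms by (intro prod_zero bexI[of _ k]) (auto simp: f_def)
  finally show ?thesis .
qed

lemma sum_signs_square:
  assumes D: "finite D"
  shows "(\<Sum>\<sigma>\<in>signs D. (\<Sum>k\<in>D. a k * \<sigma> k)\<^sup>2) = 2 ^ card D * (\<Sum>k\<in>D. (a k)\<^sup>2)"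
proof -
  have "(\<Sum>\<sigma>\<in>signs D. (\<Sum>k\<in>D. a k * \<sigma> k)\<^sup>2)
      = (\<Sum>\<sigma>\<in>signs D. \<Sum>k\<in>D. \<Sum>l\<in>D. a k * a l * (\<sigma> k * \<sigma> l))"
    by (simp add: power2_eq_square sum_product algebra_simps)
  also have "\<dots> = (\<Sum>k\<in>D. \<Sum>l\<in>D. a k * a l * (\<Sum>\<sigma>\<in>signs D. \<sigma> k * \<sigma> l))"
    unfolding sum_distrib_left
    by (subst sum.swap, rule sum.cong[OF refl], subst sum.swap, rule refl)
  also have "\<dots> = (\<Sum>k\<in>D. \<Sum>l\<in>D. if l = k then 2 ^ card D * (a k)\<^sup>2 else 0)"
  proof (intro sum.cong refl)
    fix k l assume kl: "k \<in> D" "l \<in> D"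
    have "(\<Sum>\<sigma>\<in>signs D. \<sigma> k * \<sigma> k) = (\<Sum>\<sigma>\<in>signs D. 1)"
      using kl by (intro sum.cong refl) (auto simp: signs_def PiE_iff)
    then show "a k * a l * (\<Sum>\<sigma>\<in>signs D. \<sigma> k * \<sigma> l) = (if l = k then 2 ^ card D * (a k)\<^sup>2 else 0)"
      using sum_signs_mult[OF D kl] card_signs[OF D] by (auto simp: power2_eq_square)
  qed
  also have "\<dots> = 2 ^ card D * (\<Sum>k\<in>D. (a k)\<^sup>2)"
    using D by (simp flip: sum_distrib_left)
  finally show ?thesis .
qed

lemma cosh_le_exp_square:
  fixes t :: real
  assumes "\<bar>t\<bar> \<le> 1"
  shows "cosh t \<le> exp (t\<^sup>2)"
proof -
  have *: "cosh u \<le> 1 + u\<^sup>2" if "0 \<le> u" "u \<le> 1" for u :: real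
  proof -
    have "1 \<le> (1 - u + u\<^sup>2) * (1 + u)"
      using that by (simp add: algebra_simps power2_eq_square)
    also have "\<dots> \<le> (1 - u + u\<^sup>2) * exp u"
    proof (rule mult_left_mono)
      show "0 \<le> 1 - u + u\<^sup>2" using that zero_le_power2[of u] by linarith
    qed (rule exp_ge_add_one_self)
    finally have "exp (-u) \<le> 1 - u + u\<^sup>2"
      by (simp add: exp_minus inverse_eq_divide divide_le_eq)
    then show ?thesis using exp_bound[OF that] by (simp add: cosh_field_def)
  qed
  have "cosh t = cosh \<bar>t\<bar>" by (simp add: abs_if)
  also have "\<dots> \<le> 1 + t\<^sup>2" using *[of "\<bar>t\<bar>"] assms by simp
  also have "\<dots> \<le> exp (t\<^sup>2)" by (rule exp_ge_add_one_self)
  finally show ?thesis .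
qed

text \<open>
  This replaces Rosenthal's inequality. The mean of the hyperbolic cosine factors into terms of
  size at most \<open>exp ((a k)\<^sup>2)\<close>, which makes the bound linear in the variance. A constant bound would not do,
  because such estimates are added up over all coordinates, where only the sum of the variances is small.
\<close>
lemma sum_signs_cosh_le:
  assumes D: "finite D" and a: "(\<Sum>k\<in>D. (a k)\<^sup>2) \<le> 1"
  shows "(\<Sum>\<sigma>\<in>signs D. cosh (\<Sum>k\<in>D. a k * \<sigma> k) - 1) \<le> 2 ^ card D * (2 * (\<Sum>k\<in>D. (a k)\<^sup>2))"
proof -
  define v where "v = (\<Sum>k\<in>D. (a k)\<^sup>2)"
  have v: "0 \<le> v" "v \<le> 1" using a by (auto simp: v_def intro: sum_nonneg)
  have ak: "\<bar>a k\<bar> \<le> 1" if "k \<in> D" for k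
  proof -
    have "(a k)\<^sup>2 \<le> v" unfolding v_def using D that by (intro member_le_sum) auto
    then have "(a k)\<^sup>2 \<le> 1" using v by linarith
    then show ?thesis by (simp only: abs_square_le_1)
  qed
  \<comment> \<open>By symmetry of the signs the two exponentials that make up the hyperbolic cosine have the same sum.\<close>
  have half: "(\<Sum>\<sigma>\<in>signs D. exp (r * (\<Sum>k\<in>D. a k * \<sigma> k))) = 2 ^ card D * (\<Prod>k\<in>D. cosh (a k))"
    if "r = 1 \<or> r = -1" for r
  proof -
    have "(\<Sum>\<sigma>\<in>signs D. exp (r * (\<Sum>k\<in>D. a k * \<sigma> k))) = (\<Prod>k\<in>D. exp (- (r * a k)) + exp (r * a k))"
      using sum_signs_prod[OF D, of "\<lambda>k y. exp (r * (a k * y))"]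
      by (simp add: sum_distrib_left exp_sum D)
    also have "\<dots> = (\<Prod>k\<in>D. 2 * cosh (a k))"
      using that by (intro prod.cong refl) (auto simp: cosh_field_def)
    finally show ?thesis by (simp add: prod.distrib)
  qed
  have "(\<Sum>\<sigma>\<in>signs D. cosh (\<Sum>k\<in>D. a k * \<sigma> k)) = 2 ^ card D * (\<Prod>k\<in>D. cosh (a k))"
    using half[of 1] half[of "-1"]
    by (simp add: cosh_field_def add_divide_distrib sum.distrib flip: sum_divide_distrib)
  also have "\<dots> \<le> 2 ^ card D * (\<Prod>k\<in>D. exp ((a k)\<^sup>2))"
    by (intro mult_left_mono prod_mono) (auto simp: cosh_le_exp_square ak)
  also have "(\<Prod>k\<in>D. exp ((a k)\<^sup>2)) = exp v"
    unfolding v_def by (simp add: exp_sum D)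
  also have "exp v \<le> 1 + 2 * v"
    using exp_bound[OF v] power_decreasing[of 1 2 v] v by simp
  finally have "(\<Sum>\<sigma>\<in>signs D. cosh (\<Sum>k\<in>D. a k * \<sigma> k)) \<le> 2 ^ card D * (1 + 2 * v)"
    by simp
  then show ?thesis
    by (simp add: sum_subtractf card_signs[OF D] algebra_simps flip: v_def)
qed

lemma even_power_le_cosh:
  fixes t :: real
  assumes "even n" "0 < n"
  shows "t ^ n \<le> fact n * (cosh t - 1)"
proof -
  let ?f = "\<lambda>n. if even n then t ^ n /\<^sub>R fact n else 0"
  have "sum ?f {0, n} \<le> suminf ?f"
    using cosh_converges[of t]
    by (intro sum_le_suminf) (auto simp: sums_iff zero_le_even_power)
  then show ?thesis
    using assms cosh_converges[of t] by (simp add: sums_iff field_simps)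
qed

text \<open>
  The assumption \<open>r \<ge> 2\<close> is what makes this true near zero, where \<open>cosh t - 1\<close> behaves like \<open>t\<^sup>2 / 2\<close>; it
  is the place where \<open>q \<le> 2\<close> enters the lower bound.
\<close>
lemma powr_le_cosh:
  fixes r :: real
  assumes "2 \<le> r"
  obtains C where "0 < C" "\<And>t. \<bar>t\<bar> powr r \<le> C * (cosh t - 1)"
proof
  \<comment> \<open>Any even power beyond \<open>r\<close> dominates for \<open>\<bar>t\<bar> \<ge> 1\<close>, and \<open>t\<^sup>2\<close> does for \<open>\<bar>t\<bar> \<le> 1\<close>.\<close>
  define n where "n = 2 * nat \<lceil>r\<rceil>"
  have n: "even n" "0 < n" "r \<le> real n" using assms by (auto simp: n_def) linarith
  show "0 < 2 + (fact n :: real)" by (simp add: add_pos_pos)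
  show "\<bar>t\<bar> powr r \<le> (2 + fact n) * (cosh t - 1)" for t
  proof -
    have "\<bar>t\<bar> powr r \<le> t ^ 2 + t ^ n"
    proof (cases "\<bar>t\<bar> \<le> 1")
      case True
      have "\<bar>t\<bar> powr r \<le> \<bar>t\<bar> powr 2"
        using True assms by (intro powr_mono') auto
      then show ?thesis using n zero_le_even_power[of n t] by (simp add: add_increasing2)
    next
      case False
      have "\<bar>t\<bar> powr r \<le> \<bar>t\<bar> powr n"
        using False n by (intro powr_mono) auto
      then show ?thesis using n False by (simp add: powr_realpow power_even_abs add_increasing)
    qed
    also have "\<dots> \<le> fact 2 * (cosh t - 1) + fact n * (cosh t - 1)"
      using even_power_le_cosh[of 2 t] even_power_le_cosh[of n t] n by simp
    finally show ?thesis by (simp add: algebra_simps)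
  qed
qed

section \<open>Coordinate weights that bound distances from below\<close>

text \<open>
  Young's inequality with an arbitrarily small coefficient on one factor. It takes
  the place of Hoelder's inequality below: summed over the coordinates, its additive form needs only one
  linear combination of a second moment and an \<open>r\<close>-th moment to be controlled.
\<close>
lemma dual_exponent_young:
  fixes q :: real
  assumes q: "1 < q" and r1: "1 < r" and r: "1 / q + 1 / r = 1" and \<eta>: "0 < \<eta>"
  obtains K where "0 < K" "\<And>a s. a * s \<le> \<eta> * \<bar>s\<bar> powr r + K * \<bar>a\<bar> powr q"
proof
  define \<theta> where "\<theta> = \<eta> powr (1 / r)"
  have \<theta>: "0 < \<theta>" "\<theta> powr r = \<eta>"
    using \<eta> r1 by (auto simp: \<theta>_def powr_powr)
  show "0 < \<theta> powr - q" using \<theta> by simp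
  show "a * s \<le> \<eta> * \<bar>s\<bar> powr r + \<theta> powr - q * \<bar>a\<bar> powr q" for a s
  proof -
    have "a * s \<le> (\<bar>a\<bar> / \<theta>) * (\<theta> * \<bar>s\<bar>)"
      using \<theta> by (simp flip: abs_mult)
    also have "\<dots> \<le> (\<bar>a\<bar> / \<theta>) powr q / q + (\<theta> * \<bar>s\<bar>) powr r / r"
      using q r1 r \<theta> by (intro Youngs_inequality) auto
    also have "\<dots> \<le> (\<bar>a\<bar> / \<theta>) powr q / 1 + (\<theta> * \<bar>s\<bar>) powr r / 1"
      using q r1 by (intro add_mono divide_left_mono) auto
    also have "\<dots> = \<eta> * \<bar>s\<bar> powr r + \<theta> powr - q * \<bar>a\<bar> powr q"
      using \<theta> by (simp add: powr_mult powr_divide powr_minus field_simps)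
    finally show ?thesis .
  qed
qed

text \<open>
  The weight \<open>w\<close> bounds distances from \<open>V\<close> on all sets \<open>D\<close> of coordinates at once. The set is left free so
  that it can be selected afterwards by averaging \<open>w\<close>.
\<close>
definition distance_weight ::
  "real \<Rightarrow> real \<Rightarrow> 'a set \<Rightarrow> ('a \<Rightarrow> real) set \<Rightarrow> ('a \<Rightarrow> real) \<Rightarrow> bool" where
  "distance_weight q c I V w \<longleftrightarrow>
     (\<forall>D\<subseteq>I. \<exists>u. (\<forall>i. \<bar>u i\<bar> \<le> 1) \<and> (\<forall>i. i \<notin> D \<longrightarrow> u i = 0) \<and>
       (\<forall>y\<in>V. c * (\<Sum>i\<in>D. w i) \<le> (\<Sum>i\<in>I. \<bar>u i - y i\<bar> powr q)))"

text \<open>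
  The case \<open>q > 1\<close>. For random signs \<open>\<sigma>\<close> on \<open>D\<close>, let \<open>S\<close> be the image of \<open>\<sigma>\<close> under \<open>P\<close>. Its squared length
  has mean \<open>\<tau> = (\<Sum>k\<in>D. P k k)\<close>, and the mean of the sum of the \<open>r\<close>-th powers of its entries is at most a
  multiple of \<open>\<tau>\<close>, so for small \<open>\<eta>\<close> and some \<open>\<sigma>\<close> the squared length exceeds \<open>\<eta>\<close> times that sum by at
  least \<open>\<tau> / 2\<close>. As \<open>S\<close> annihilates
  \<open>V\<close> and is a projection of \<open>\<sigma>\<close>, its squared length is the pairing of \<open>\<sigma> - y\<close> with \<open>S\<close>, which Young's
  inequality bounds through the distance of \<open>\<sigma>\<close> from \<open>y\<close>.
\<close>
lemma distance_weight_projection_diagonal: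
  fixes q :: real
  assumes q: "1 < q" "q \<le> 2"
  shows "\<exists>c>0. \<forall>(I :: 'a set) B P. finite I \<longrightarrow> annihilator_projection I B P \<longrightarrow>
    distance_weight q c I {y. \<forall>i\<in>I. (\<Sum>k\<in>I. P i k * y k) = 0} (\<lambda>k. P k k)"
proof -
  define r where "r = q / (q - 1)"
  have r: "1 / q + 1 / r = 1" "2 \<le> r" using q by (auto simp: r_def field_simps)
  obtain C where C: "0 < C" "\<And>t. \<bar>t\<bar> powr r \<le> C * (cosh t - 1)"
    using powr_le_cosh[OF r(2)] by blast
  \<comment> \<open>Chosen so that the \<open>r\<close>-th moments, at most \<open>2 C \<tau>\<close>, consume half of the second moment \<open>\<tau>\<close>.\<close>
  define \<eta> where "\<eta> = 1 / (4 * C)"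
  have \<eta>: "0 < \<eta>" using C by (simp add: \<eta>_def)
  obtain K where K: "0 < K" "\<And>a s. a * s \<le> \<eta> * \<bar>s\<bar> powr r + K * \<bar>a\<bar> powr q"
    using dual_exponent_young[OF q(1) _ r(1) \<eta>] r(2) by auto
  show ?thesis
    unfolding distance_weight_def
  proof (rule exI[of _ "1 / (2 * K)"], intro conjI allI impI)
    show "0 < 1 / (2 * K)" using K by simp
    fix I :: "'a set" and B P D
    assume I: "finite I" and P: "annihilator_projection I B P" and D: "D \<subseteq> I"
    have gram: "(\<Sum>k\<in>I. P i k * P j k) = P i j" if "i \<in> I" "j \<in> I" for i j
      using P that by (simp add: annihilator_projection_def)
    have sym: "P i j = P j i" if "i \<in> I" "j \<in> I" for i j
      using gram[OF that] gram[OF that(2,1)] by (simp add: mult.commute)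
    have finD: "finite D" using D I by (rule finite_subset)
    define \<tau> where "\<tau> = (\<Sum>k\<in>D. P k k)"
    define S where "S \<sigma> i = (\<Sum>k\<in>D. P i k * \<sigma> k)" for \<sigma> i
    have row: "(\<Sum>k\<in>I. (P i k)\<^sup>2) = P i i" if "i \<in> I" for i
      using gram[OF that that] by (simp add: power2_eq_square)
    have row_le: "(\<Sum>k\<in>D. (P i k)\<^sup>2) \<le> 1" if "i \<in> I" for i
    proof -
      have "(\<Sum>k\<in>D. (P i k)\<^sup>2) \<le> P i i"
        unfolding row[OF that, symmetric] using I D by (intro sum_mono2) auto
      moreover have "(P i i)\<^sup>2 \<le> P i i"
        by (subst row[OF that, symmetric], rule member_le_sum) (use I that in auto)
      then have "P i i \<le> 1"
        unfolding power2_eq_square by (cases "0 < P i i") auto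
      ultimately show ?thesis by linarith
    qed
    have col: "(\<Sum>i\<in>I. \<Sum>k\<in>D. (P i k)\<^sup>2) = \<tau>"
    proof -
      have "(\<Sum>i\<in>I. \<Sum>k\<in>D. (P i k)\<^sup>2) = (\<Sum>k\<in>D. \<Sum>i\<in>I. (P k i)\<^sup>2)"
        using D by (subst sum.swap, intro sum.cong refl arg_cong[where f = "\<lambda>x. x\<^sup>2"] sym) auto
      also have "\<dots> = \<tau>"
        unfolding \<tau>_def using D by (intro sum.cong refl row) auto
      finally show ?thesis .
    qed
    have second: "(\<Sum>\<sigma>\<in>signs D. \<Sum>i\<in>I. (S \<sigma> i)\<^sup>2) = 2 ^ card D * \<tau>"
      unfolding S_def by (subst sum.swap) (simp add: sum_signs_square[OF finD] col flip: sum_distrib_left)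
    have "(\<Sum>\<sigma>\<in>signs D. \<Sum>i\<in>I. \<bar>S \<sigma> i\<bar> powr r) \<le> (\<Sum>\<sigma>\<in>signs D. \<Sum>i\<in>I. C * (cosh (S \<sigma> i) - 1))"
      using C by (intro sum_mono) auto
    also have "\<dots> = C * (\<Sum>i\<in>I. \<Sum>\<sigma>\<in>signs D. cosh (S \<sigma> i) - 1)"
      by (subst sum.swap) (simp only: sum_distrib_left)
    also have "\<dots> \<le> C * (\<Sum>i\<in>I. 2 ^ card D * (2 * (\<Sum>k\<in>D. (P i k)\<^sup>2)))"
      unfolding S_def using C row_le by (intro mult_left_mono sum_mono sum_signs_cosh_le finD) auto
    also have "\<dots> = 2 ^ card D * (2 * C * \<tau>)"
      by (simp add: col flip: sum_distrib_left)
    finally have high: "(\<Sum>\<sigma>\<in>signs D. \<Sum>i\<in>I. \<bar>S \<sigma> i\<bar> powr r) \<le> 2 ^ card D * (2 * C * \<tau>)" .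
    have "\<exists>\<sigma>\<in>signs D. \<tau> / 2 \<le> (\<Sum>i\<in>I. (S \<sigma> i)\<^sup>2) - \<eta> * (\<Sum>i\<in>I. \<bar>S \<sigma> i\<bar> powr r)"
    proof (rule ccontr)
      assume "\<not> ?thesis"
      then have "(\<Sum>\<sigma>\<in>signs D. (\<Sum>i\<in>I. (S \<sigma> i)\<^sup>2) - \<eta> * (\<Sum>i\<in>I. \<bar>S \<sigma> i\<bar> powr r)) < (\<Sum>\<sigma>\<in>signs D. \<tau> / 2)"
        using finite_signs[OF finD] card_signs[OF finD]
        by (intro sum_strict_mono) (auto simp: not_le)
      then have "2 ^ card D * \<tau> - \<eta> * (\<Sum>\<sigma>\<in>signs D. \<Sum>i\<in>I. \<bar>S \<sigma> i\<bar> powr r) < 2 ^ card D * (\<tau> / 2)"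
        by (simp add: sum_subtractf second card_signs[OF finD] flip: sum_distrib_left)
      moreover have "\<eta> * (\<Sum>\<sigma>\<in>signs D. \<Sum>i\<in>I. \<bar>S \<sigma> i\<bar> powr r) \<le> \<eta> * (2 ^ card D * (2 * C * \<tau>))"
        using high \<eta> by (intro mult_left_mono) auto
      moreover have "\<eta> * (2 ^ card D * (2 * C * \<tau>)) = 2 ^ card D * (\<tau> / 2)"
        using C by (simp add: \<eta>_def)
      moreover have "2 ^ card D * \<tau> = 2 * (2 ^ card D * (\<tau> / 2))" by simp
      ultimately show False by linarith
    qed
    then obtain \<sigma> where \<sigma>: "\<sigma> \<in> signs D"
      and big: "\<tau> / 2 \<le> (\<Sum>i\<in>I. (S \<sigma> i)\<^sup>2) - \<eta> * (\<Sum>i\<in>I. \<bar>S \<sigma> i\<bar> powr r)" by blast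
    define u where "u i = (if i \<in> D then \<sigma> i else 0)" for i
    have Pu: "(\<Sum>k\<in>I. P i k * u k) = S \<sigma> i" for i
      unfolding S_def u_def using D I by (intro sum.mono_neutral_cong_right) auto
    show "\<exists>u. (\<forall>i. \<bar>u i\<bar> \<le> 1) \<and> (\<forall>i. i \<notin> D \<longrightarrow> u i = 0) \<and>
        (\<forall>y\<in>{y. \<forall>i\<in>I. (\<Sum>k\<in>I. P i k * y k) = 0}.
          1 / (2 * K) * (\<Sum>k\<in>D. P k k) \<le> (\<Sum>i\<in>I. \<bar>u i - y i\<bar> powr q))"
    proof (intro exI[of _ u] conjI allI impI ballI)
      show "\<bar>u i\<bar> \<le> 1" for i
        using \<sigma> by (auto simp: u_def signs_def PiE_iff dest!: bspec)
      show "u i = 0" if "i \<notin> D" for i using that by (simp add: u_def)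
      fix y assume "y \<in> {y. \<forall>i\<in>I. (\<Sum>k\<in>I. P i k * y k) = 0}"
      then have y: "\<forall>i\<in>I. (\<Sum>k\<in>I. P i k * y k) = 0" by simp
      have PS: "(\<Sum>i\<in>I. P k i * S \<sigma> i) = S \<sigma> k" if "k \<in> I" for k
      proof -
        have "(\<Sum>i\<in>I. P k i * S \<sigma> i) = (\<Sum>l\<in>D. \<Sum>i\<in>I. P k i * P i l * \<sigma> l)"
          unfolding S_def sum_distrib_left by (subst sum.swap) (simp add: mult.assoc)
        also have "\<dots> = S \<sigma> k"
          unfolding S_def
        proof (intro sum.cong refl)
          fix l assume "l \<in> D"
          then have "(\<Sum>i\<in>I. P k i * P i l) = (\<Sum>i\<in>I. P k i * P l i)"
            using D by (intro sum.cong refl) (auto simp: sym[of _ l])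
          then show "(\<Sum>i\<in>I. P k i * P i l * \<sigma> l) = P k l * \<sigma> l"
            using gram[of k l] that D \<open>l \<in> D\<close> by (auto simp flip: sum_distrib_right)
        qed
        finally show ?thesis .
      qed
      \<comment> \<open>Pairing with \<open>S\<close> only sees the projection of a vector, because \<open>S\<close> is fixed by \<open>P\<close>.\<close>
      have inner: "(\<Sum>i\<in>I. x i * S \<sigma> i) = (\<Sum>i\<in>I. S \<sigma> i * (\<Sum>k\<in>I. P i k * x k))" for x
      proof -
        have "(\<Sum>i\<in>I. x i * S \<sigma> i) = (\<Sum>k\<in>I. \<Sum>i\<in>I. x k * (P k i * S \<sigma> i))"
          by (intro sum.cong refl) (simp add: PS flip: sum_distrib_left)
        also have "\<dots> = (\<Sum>i\<in>I. \<Sum>k\<in>I. x k * (P k i * S \<sigma> i))" by (rule sum.swap)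
        also have "\<dots> = (\<Sum>i\<in>I. S \<sigma> i * (\<Sum>k\<in>I. P i k * x k))"
          unfolding sum_distrib_left by (intro sum.cong refl) (simp add: sym mult_ac)
        finally show ?thesis .
      qed
      have "(\<Sum>i\<in>I. (S \<sigma> i)\<^sup>2) = (\<Sum>i\<in>I. (u i - y i) * S \<sigma> i)"
        using inner[of u] inner[of y] y
        by (simp add: left_diff_distrib sum_subtractf Pu power2_eq_square)
      also have "\<dots> \<le> (\<Sum>i\<in>I. \<eta> * \<bar>S \<sigma> i\<bar> powr r + K * \<bar>u i - y i\<bar> powr q)"
        by (intro sum_mono K)
      also have "\<dots> = \<eta> * (\<Sum>i\<in>I. \<bar>S \<sigma> i\<bar> powr r) + K * (\<Sum>i\<in>I. \<bar>u i - y i\<bar> powr q)"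
        by (simp add: sum.distrib sum_distrib_left)
      finally have "\<tau> / 2 \<le> K * (\<Sum>i\<in>I. \<bar>u i - y i\<bar> powr q)" using big by linarith
      then show "1 / (2 * K) * (\<Sum>k\<in>D. P k k) \<le> (\<Sum>i\<in>I. \<bar>u i - y i\<bar> powr q)"
        using K by (simp add: field_simps flip: \<tau>_def)
    qed
  qed
qed

section \<open>Comparison of the norms\<close>
lemma recip_finite:
  assumes "1 \<le> p" "p \<noteq> \<infinity>"
  shows "1 \<le> enn2real p" "recip p = 1 / enn2real p"
proof -
  obtain r where r: "0 \<le> r" "p = ennreal r"
    using assms by (cases p) auto
  then have "1 \<le> r" using assms by simp
  then show "1 \<le> enn2real p" using r by simp
  have "1 / p = ennreal 1 / ennreal r" using r by simp
  also have "\<dots> = ennreal (1 / r)" using \<open>1 \<le> r\<close> by (intro divide_ennreal) auto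
  finally show "recip p = 1 / enn2real p" using r by (simp add: recip_def)
qed

lemma lp_norm_ennreal:
  assumes "0 \<le> q"
  shows "lp_norm (ennreal q) I x = (\<Sum>i\<in>I. \<bar>x i\<bar> powr q) powr (1 / q)"
  using assms by (simp add: lp_norm_def)

lemma lp_norm_nonneg:
  assumes "finite I" "I \<noteq> {}"
  shows "0 \<le> lp_norm p I x"
proof -
  obtain i where "i \<in> I" using assms by blast
  then have "\<bar>x i\<bar> \<le> Max ((\<lambda>i. \<bar>x i\<bar>) ` I)" using assms by (intro Max_ge) auto
  then show ?thesis by (auto simp: lp_norm_def)
qed

text \<open>
  Counting only the nonzero entries lets one estimate cover vectors spread over a block (\<open>k\<close> is its length)
  and vectors concentrated on one entry (\<open>k = 1\<close>).
\<close>
lemma lp_norm_sparse_le: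
  assumes I: "finite I" "I \<noteq> {}" and p: "1 \<le> p" and M: "\<And>i. i \<in> I \<Longrightarrow> \<bar>x i\<bar> \<le> M"
    and k: "card {i\<in>I. x i \<noteq> 0} \<le> k"
    and k0: "k \<noteq> 0"
  shows "lp_norm p I x \<le> real k powr recip p * M"
proof (cases "p = \<infinity>")
  case True
  then have "lp_norm p I x = Max ((\<lambda>i. \<bar>x i\<bar>) ` I)" by (simp add: lp_norm_def)
  also have "\<dots> \<le> M" using I M by (intro Max.boundedI) auto
  moreover have "recip p = 0" using True by (simp only: recip_infinity)
  ultimately show ?thesis using k0 by simp
next
  case False
  define r where "r = enn2real p"
  have r: "1 \<le> r" "recip p = 1 / r" using recip_finite[OF p False] by (auto simp: r_def)
  have M0: "0 \<le> M" using I M by fastforce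
  have "(\<Sum>i\<in>I. \<bar>x i\<bar> powr r) = (\<Sum>i\<in>{i\<in>I. x i \<noteq> 0}. \<bar>x i\<bar> powr r)"
    using I by (intro sum.mono_neutral_right) auto
  also have "\<dots> \<le> of_nat (card {i\<in>I. x i \<noteq> 0}) * M powr r"
    using M r by (intro sum_bounded_above powr_mono2) auto
  also have "\<dots> \<le> real k * M powr r"
    using k by (intro mult_right_mono) auto
  finally have "(\<Sum>i\<in>I. \<bar>x i\<bar> powr r) powr (1 / r) \<le> (real k * M powr r) powr (1 / r)"
    using r by (intro powr_mono2) (auto intro: sum_nonneg)
  also have "\<dots> = real k powr (1 / r) * M"
    using r M0 by (simp add: powr_mult powr_powr)
  finally show ?thesis using False r by (simp add: lp_norm_def r_def)
qed

lemma lp_norm_le_lp_norm: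
  fixes q :: real
  assumes I: "finite I" "I \<noteq> {}" and q: "1 \<le> q" and p: "1 \<le> p"
  shows "lp_norm (ennreal q) I x \<le> real (card I) powr max (1 / q - recip p) 0 * lp_norm p I x"
proof -
  have k: "0 < card I" using I by (simp add: card_gt_0_iff)
  have q': "recip (ennreal q) = 1 / q" "1 \<le> ennreal q" using recip_finite[of "ennreal q"] q by auto
  have supp: "card {i\<in>I. x i \<noteq> 0} \<le> card I" using I by (intro card_mono) auto
  have bound: "lp_norm (ennreal q) I x \<le> real (card I) powr (1 / q) * M"
    if "\<And>i. i \<in> I \<Longrightarrow> \<bar>x i\<bar> \<le> M" for M
    using lp_norm_sparse_le[OF I q'(2) that supp] k q' by simp
  show ?thesis
  proof (cases "p = \<infinity>")
    case True
    then have "\<bar>x i\<bar> \<le> lp_norm p I x" if "i \<in> I" for i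
      using I that by (auto simp: lp_norm_def intro!: Max_ge)
    moreover have "recip p = 0" using True by (simp only: recip_infinity)
    ultimately show ?thesis using bound q by (simp add: max_def)
  next
    case False
    define r where "r = enn2real p"
    have r: "1 \<le> r" "recip p = 1 / r" using recip_finite[OF p False] by (auto simp: r_def)
    define T where "T = (\<Sum>i\<in>I. \<bar>x i\<bar> powr r)"
    define M where "M = T powr (1 / r)"
    have M: "lp_norm p I x = M" using False by (simp add: lp_norm_def M_def T_def r_def)
    have T0: "0 \<le> T" unfolding T_def by (intro sum_nonneg) auto
    then have Mr: "M powr r = T" using r by (simp add: M_def powr_powr)
    show ?thesis
    proof (cases "T = 0")
      case True
      then have "\<forall>i\<in>I. x i = 0"
        unfolding T_def using I by (subst (asm) sum_nonneg_eq_0_iff) auto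
      then show ?thesis using bound[of 0] by (simp add: M M_def True)
    next
      case False
      then have "0 < T" using T0 by simp
      then have M0: "0 < M" by (simp add: M_def)
      show ?thesis
      proof (cases "r \<le> q")
        case True
        have xM: "\<bar>x i\<bar> \<le> M" if "i \<in> I" for i
        proof -
          have "\<bar>x i\<bar> powr r \<le> T" unfolding T_def using I that by (intro member_le_sum) auto
          then have "(\<bar>x i\<bar> powr r) powr (1 / r) \<le> T powr (1 / r)" using r by (intro powr_mono2) auto
          then show ?thesis using r by (simp add: powr_powr M_def)
        qed
        have "(\<Sum>i\<in>I. \<bar>x i\<bar> powr q) \<le> (\<Sum>i\<in>I. \<bar>x i\<bar> powr r * M powr (q - r))"
        proof (intro sum_mono)
          fix i assume "i \<in> I"
          have "\<bar>x i\<bar> powr q = \<bar>x i\<bar> powr r * \<bar>x i\<bar> powr (q - r)" by (simp flip: powr_add)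
          also have "\<dots> \<le> \<bar>x i\<bar> powr r * M powr (q - r)"
            using xM[OF \<open>i \<in> I\<close>] True by (intro mult_left_mono powr_mono2) auto
          finally show "\<bar>x i\<bar> powr q \<le> \<bar>x i\<bar> powr r * M powr (q - r)" .
        qed
        also have "\<dots> = M powr r * M powr (q - r)"
          by (simp add: Mr T_def sum_distrib_right)
        also have "\<dots> = M powr q" by (simp flip: powr_add)
        finally have "(\<Sum>i\<in>I. \<bar>x i\<bar> powr q) powr (1 / q) \<le> (M powr q) powr (1 / q)"
          using q by (intro powr_mono2) (auto intro: sum_nonneg)
        moreover have "max (1 / q - recip p) 0 = 0" using True r q by (simp add: frac_le)
        ultimately show ?thesis using q M M0 k by (simp add: lp_norm_ennreal powr_powr)
      next
        case False
        \<comment> \<open>Scaled by \<open>\<rho>\<close>, the \<open>r\<close>-th powers of the entries have mean one, and Young's inequality against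
          the constant one bounds the mean of their \<open>q\<close>-th powers by one.\<close>
        define n where "n = real (card I)"
        define \<rho> where "\<rho> = M * n powr (- (1 / r))"
        have n: "0 < n" using k by (simp add: n_def)
        have \<rho>0: "0 < \<rho>" using M0 n by (simp add: \<rho>_def)
        have \<rho>r: "\<rho> powr r = T / n"
        proof -
          have "\<rho> powr r = M powr r * (n powr (- (1 / r))) powr r"
            using M0 n by (simp add: \<rho>_def powr_mult)
          also have "(n powr (- (1 / r))) powr r = 1 / n"
          proof -
            have "(n powr (- (1 / r))) powr r = n powr (- 1)" using r by (simp only: powr_powr) simp
            then show ?thesis using n by (simp add: powr_minus_divide)
          qed
          finally show ?thesis by (simp add: Mr)
        qed
        have young: "t powr q \<le> (q / r) * t powr r + (1 - q / r)" if "0 \<le> t" for t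
        proof -
          have "t powr q * 1 \<le> (t powr q) powr (r / q) / (r / q) + 1 powr (r / (r - q)) / (r / (r - q))"
            using False q by (intro Youngs_inequality) (auto simp: field_simps)
          then show ?thesis using False q by (simp add: powr_powr diff_divide_distrib mult.commute)
        qed
        have "(\<Sum>i\<in>I. \<bar>x i\<bar> powr q) = \<rho> powr q * (\<Sum>i\<in>I. (\<bar>x i\<bar> / \<rho>) powr q)"
          using \<rho>0 by (simp add: sum_distrib_left powr_divide)
        also have "\<dots> \<le> \<rho> powr q * (\<Sum>i\<in>I. (q / r) * (\<bar>x i\<bar> / \<rho>) powr r + (1 - q / r))"
          using \<rho>0 by (intro mult_left_mono sum_mono young) auto
        also have "(\<Sum>i\<in>I. (q / r) * (\<bar>x i\<bar> / \<rho>) powr r + (1 - q / r)) = (q / r) * (T / \<rho> powr r) + n * (1 - q / r)"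
          using \<rho>0 by (simp add: sum.distrib powr_divide T_def n_def sum_distrib_left sum_divide_distrib)
        also have "\<dots> = n" using \<rho>r \<open>0 < T\<close> n by (simp add: algebra_simps)
        finally have "(\<Sum>i\<in>I. \<bar>x i\<bar> powr q) powr (1 / q) \<le> (\<rho> powr q * n) powr (1 / q)"
          using q by (intro powr_mono2) (auto intro: sum_nonneg)
        also have "\<dots> = n powr (1 / q) * \<rho>" using q \<rho>0 n by (simp add: powr_mult powr_powr)
        also have "\<dots> = n powr (1 / q - 1 / r) * M" by (simp add: \<rho>_def flip: powr_add)
        finally have "lp_norm (ennreal q) I x \<le> n powr (1 / q - recip p) * lp_norm p I x"
          using q r M by (simp add: lp_norm_ennreal)
        moreover have "max (1 / q - recip p) 0 = 1 / q - recip p"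
          using False q r by (simp add: frac_le)
        ultimately show ?thesis by (simp only: n_def)
      qed
    qed
  qed
qed

lemma block_card:
  fixes s j :: nat
  assumes "1 \<le> s" "1 \<le> j"
  shows "finite {s * (j - 1)<..s * j}" "card {s * (j - 1)<..s * j} = s" "{s * (j - 1)<..s * j} \<noteq> {}"
proof -
  have "s * j - s * (j - 1) = s" using assms by (simp flip: diff_mult_distrib2)
  then show "card {s * (j - 1)<..s * j} = s" by simp
  then show "{s * (j - 1)<..s * j} \<noteq> {}" using assms(1) by force
qed simp

lemma sum_blocks:
  fixes f :: "nat \<Rightarrow> 'a::comm_monoid_add"
  shows "(\<Sum>i\<in>{1..s * b}. f i) = (\<Sum>j\<in>{1..b}. \<Sum>i\<in>{s * (j - 1)<..s * j}. f i)"
proof (induction b)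
  case (Suc b)
  have "{1..s * Suc b} = {1..s * b} \<union> {s * b<..s * Suc b}" by auto
  then have "(\<Sum>i\<in>{1..s * Suc b}. f i) = (\<Sum>i\<in>{1..s * b}. f i) + (\<Sum>i\<in>{s * b<..s * Suc b}. f i)"
    by (simp only:) (rule sum.union_disjoint, auto)
  then show ?case using Suc by simp
qed simp

lemma lp_norm_le_mixed_norm:
  fixes q :: real
  assumes q: "1 \<le> q" and p: "1 \<le> p1" "1 \<le> p2" and sb: "1 \<le> s" "1 \<le> b"
  shows "lp_norm (ennreal q) {1..s * b} x
    \<le> real s powr max (1 / q - recip p1) 0 * real b powr max (1 / q - recip p2) 0 * mixed_norm s b p1 p2 x"
proof -
  define A where "A = real s powr max (1 / q - recip p1) 0"
  define blk where "blk j = {s * (j - 1)<..s * j}" for j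
  have blk: "finite (blk j)" "card (blk j) = s" "blk j \<noteq> {}" if "j \<in> {1..b}" for j
    unfolding blk_def using block_card[OF sb(1), of j] that by auto
  define h where "h j = lp_norm p1 (blk j) x" for j
  have h0: "0 \<le> h j" if "j \<in> {1..b}" for j
    unfolding h_def using blk[OF that] by (intro lp_norm_nonneg)
  have "(\<Sum>i\<in>{1..s * b}. \<bar>x i\<bar> powr q) = (\<Sum>j\<in>{1..b}. \<Sum>i\<in>blk j. \<bar>x i\<bar> powr q)"
    unfolding blk_def by (rule sum_blocks)
  also have "\<dots> \<le> (\<Sum>j\<in>{1..b}. (A * h j) powr q)"
  proof (intro sum_mono)
    fix j assume j: "j \<in> {1..b}"
    have "lp_norm (ennreal q) (blk j) x \<le> A * h j"
      using lp_norm_le_lp_norm[OF blk(1,3)[OF j] q p(1)] blk(2)[OF j] by (simp add: A_def h_def)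
    then have "lp_norm (ennreal q) (blk j) x powr q \<le> (A * h j) powr q"
      using q lp_norm_nonneg[OF blk(1,3)[OF j]] by (intro powr_mono2) auto
    then show "(\<Sum>i\<in>blk j. \<bar>x i\<bar> powr q) \<le> (A * h j) powr q"
      using q by (simp add: lp_norm_ennreal powr_powr sum_nonneg)
  qed
  also have "\<dots> = A powr q * (\<Sum>j\<in>{1..b}. \<bar>h j\<bar> powr q)"
    using h0 by (simp add: powr_mult A_def sum_distrib_left)
  finally have "(\<Sum>i\<in>{1..s * b}. \<bar>x i\<bar> powr q) powr (1 / q) \<le> (A powr q * (\<Sum>j\<in>{1..b}. \<bar>h j\<bar> powr q)) powr (1 / q)"
    using q by (intro powr_mono2) (auto intro: sum_nonneg)
  also have "\<dots> = A * lp_norm (ennreal q) {1..b} h"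
    using q by (simp add: lp_norm_ennreal powr_mult powr_powr sum_nonneg A_def)
  also have "\<dots> \<le> A * (real b powr max (1 / q - recip p2) 0 * lp_norm p2 {1..b} h)"
    using lp_norm_le_lp_norm[of "{1..b}" q p2 h] q p sb by (intro mult_left_mono) (auto simp: A_def)
  also have "lp_norm p2 {1..b} h = mixed_norm s b p1 p2 x"
    unfolding mixed_norm_def by (rule arg_cong[where f = "lp_norm p2 {1..b}"]) (simp add: h_def blk_def fun_eq_iff)
  finally show ?thesis
    using q by (simp add: lp_norm_ennreal A_def mult.assoc)
qed

lemma kolmogorov_width_mixed_ball_le:
  fixes q :: real
  assumes q: "1 \<le> q" and p: "1 \<le> p1" "1 \<le> p2" and sb: "1 \<le> s" "1 \<le> b"
  shows "kolmogorov_width n (mixed_ball s b p1 p2) (coord_space (s * b)) (lp_norm (ennreal q) {1..s * b})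
    \<le> ennreal (real s powr max (1 / q - recip p1) 0 * real b powr max (1 / q - recip p2) 0)"
    (is "_ \<le> ennreal ?R")
  unfolding kolmogorov_width_def
proof (rule INF_lower2[of "{0}"])
  have "\<exists>B. finite B \<and> {0 :: nat \<Rightarrow> real} \<subseteq> seq.span B"
    by (intro exI[of _ "{}"]) simp
  then show "{0} \<in> {Q. seq.subspace Q \<and> Q \<subseteq> coord_space (s * b) \<and> (\<exists>B. finite B \<and> Q \<subseteq> seq.span B) \<and> seq.dim Q \<le> n}"
    using seq.dim_span[of "{}"] seq.dim_eq_card_independent[OF seq.independent_empty] by (simp add: coord_space_def seq.subspace_single_0)
  show "(SUP x\<in>mixed_ball s b p1 p2. INF y\<in>{0}. ennreal (lp_norm (ennreal q) {1..s * b} (x - y))) \<le> ennreal ?R"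
  proof (rule SUP_least)
    fix x assume "x \<in> mixed_ball s b p1 p2"
    then have "?R * mixed_norm s b p1 p2 x \<le> ?R * 1"
      by (intro mult_left_mono) (auto simp: mixed_ball_def)
    then show "(INF y\<in>{0}. ennreal (lp_norm (ennreal q) {1..s * b} (x - y))) \<le> ennreal ?R"
      using lp_norm_le_mixed_norm[OF q p sb, of x] by (simp add: ennreal_leI)
  qed
qed

lemma sum_mult_span_eq_0:
  assumes "\<And>v. v \<in> B \<Longrightarrow> (\<Sum>i\<in>I. a i * v i) = 0" and "y \<in> seq.span B"
  shows "(\<Sum>i\<in>I. a i * y i) = 0"
proof -
  have "seq.subspace {v. (\<Sum>i\<in>I. a i * v i) = 0}"
    by (auto simp: seq.subspace_def scale_seq_def distrib_left sum.distrib mult.left_commute[of "a _"]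
        simp flip: sum_distrib_left)
  then have "seq.span B \<subseteq> {v. (\<Sum>i\<in>I. a i * v i) = 0}"
    using assms(1) by (intro seq.span_minimal) auto
  then show ?thesis using assms(2) by auto
qed

lemma distance_weight_antimono:
  "V \<subseteq> V' \<Longrightarrow> distance_weight q c I V' w \<Longrightarrow> distance_weight q c I V w"
  unfolding distance_weight_def by (meson subsetD)

text \<open>
  The trace of the projection and the number of tight entries of the vertex obey the same lower bound, so
  both constructions yield weights of the mass that averaging over cells requires.
\<close>
lemma exists_distance_weight:
  fixes q :: real
  assumes q: "1 \<le> q" "q \<le> 2"
  shows "\<exists>c>0. \<forall>(I :: nat set) B. finite I \<longrightarrow> finite B \<longrightarrow>
    (\<exists>w. real (card I) - real (card B) \<le> (\<Sum>i\<in>I. w i) \<and> distance_weight q c I (seq.span B) w)"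
proof (cases "q = 1")
  case False
  then have "1 < q" using q by simp
  then obtain c where c: "0 < c"
    "\<forall>(I :: nat set) B P. finite I \<longrightarrow> annihilator_projection I B P \<longrightarrow>
      distance_weight q c I {y. \<forall>i\<in>I. (\<Sum>k\<in>I. P i k * y k) = 0} (\<lambda>k. P k k)"
    using distance_weight_projection_diagonal[OF _ q(2), where 'a = nat] by blast
  show ?thesis
  proof (rule exI[of _ c], intro conjI allI impI c(1))
    fix I :: "nat set" and B :: "(nat \<Rightarrow> real) set"
    assume I: "finite I" and B: "finite B"
    obtain P where P: "annihilator_projection I B P"
      and tr: "real (card I) - real (card B) \<le> (\<Sum>i\<in>I. P i i)"
      by (rule exists_annihilator_projection[OF I B])
    have "seq.span B \<subseteq> {y. \<forall>i\<in>I. (\<Sum>k\<in>I. P i k * y k) = 0}"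
    proof (intro subsetI CollectI ballI)
      fix y i assume y: "y \<in> seq.span B" and i: "i \<in> I"
      show "(\<Sum>k\<in>I. P i k * y k) = 0"
        by (rule sum_mult_span_eq_0[OF _ y]) (use P i in \<open>simp add: annihilator_projection_def\<close>)
    qed
    moreover have "distance_weight q c I {y. \<forall>i\<in>I. (\<Sum>k\<in>I. P i k * y k) = 0} (\<lambda>k. P k k)"
      using c(2) I P by blast
    ultimately have "distance_weight q c I (seq.span B) (\<lambda>k. P k k)"
      by (rule distance_weight_antimono)
    then show "\<exists>w. real (card I) - real (card B) \<le> (\<Sum>i\<in>I. w i) \<and> distance_weight q c I (seq.span B) w"
      using tr by (intro exI[of _ "\<lambda>k. P k k"]) simp
  qed
next
  case True
  show ?thesis
  proof (rule exI[of _ 1], intro conjI allI impI)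
    fix I :: "nat set" and B :: "(nat \<Rightarrow> real) set"
    assume I: "finite I" and B: "finite B"
    obtain z where z: "\<And>i. i \<in> I \<Longrightarrow> \<bar>z i\<bar> \<le> 1" and zB: "\<And>v. v \<in> B \<Longrightarrow> (\<Sum>i\<in>I. z i * v i) = 0"
      and tight: "card I \<le> card {i\<in>I. \<bar>z i\<bar> = 1} + card B"
      using exists_vertex_of_cube_section[OF I B] by metis
    define w where "w i = (if \<bar>z i\<bar> = 1 then 1 else 0 :: real)" for i
    have "(\<Sum>i\<in>I. w i) = real (card {i\<in>I. \<bar>z i\<bar> = 1})"
      using sum_of_bool_eq[of I "\<lambda>i. \<bar>z i\<bar> = 1"] I by (simp add: w_def of_bool_def Int_def)
    then have "real (card I) - real (card B) \<le> (\<Sum>i\<in>I. w i)"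
      using tight by linarith
    moreover have "distance_weight q 1 I (seq.span B) w"
      unfolding distance_weight_def
    proof (intro allI impI)
      fix D assume D: "D \<subseteq> I"
      define u where "u i = (if i \<in> D then sgn (z i) else 0)" for i
      show "\<exists>u. (\<forall>i. \<bar>u i\<bar> \<le> 1) \<and> (\<forall>i. i \<notin> D \<longrightarrow> u i = 0) \<and>
          (\<forall>y\<in>seq.span B. 1 * (\<Sum>i\<in>D. w i) \<le> (\<Sum>i\<in>I. \<bar>u i - y i\<bar> powr q))"
      proof (intro exI[of _ u] conjI allI impI ballI)
        show "\<bar>u i\<bar> \<le> 1" for i by (simp add: u_def sgn_if)
        show "u i = 0" if "i \<notin> D" for i using that by (simp add: u_def)
        fix y assume y: "y \<in> seq.span B"
        have "(\<Sum>i\<in>D. w i) \<le> (\<Sum>i\<in>D. z i * u i)"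
          by (intro sum_mono) (auto simp: w_def u_def sgn_if)
        also have "\<dots> = (\<Sum>i\<in>I. z i * u i)"
          using I D by (intro sum.mono_neutral_left) (auto simp: u_def)
        also have "\<dots> = (\<Sum>i\<in>I. z i * (u i - y i))"
          using sum_mult_span_eq_0[OF zB y] by (simp add: right_diff_distrib sum_subtractf)
        also have "\<dots> \<le> (\<Sum>i\<in>I. \<bar>u i - y i\<bar>)"
        proof (intro sum_mono)
          fix i assume "i \<in> I"
          have "z i * (u i - y i) \<le> \<bar>z i\<bar> * \<bar>u i - y i\<bar>" by (simp flip: abs_mult)
          also have "\<dots> \<le> 1 * \<bar>u i - y i\<bar>" using z[OF \<open>i \<in> I\<close>] by (intro mult_right_mono) auto
          finally show "z i * (u i - y i) \<le> \<bar>u i - y i\<bar>" by simp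
        qed
        finally show "1 * (\<Sum>i\<in>D. w i) \<le> (\<Sum>i\<in>I. \<bar>u i - y i\<bar> powr q)"
          using True by simp
      qed
    qed
    ultimately show "\<exists>w. real (card I) - real (card B) \<le> (\<Sum>i\<in>I. w i) \<and> distance_weight q 1 I (seq.span B) w"
      by blast
  qed simp
qed

section \<open>Cells of the block grid\<close>
lemma exists_fibre_sum_ge:
  fixes w :: "'a \<Rightarrow> real"
  assumes I: "finite I" and T: "finite T" and g: "g ` I \<subseteq> T"
    and w: "real (card T) * m \<le> (\<Sum>i\<in>I. w i)" and T0: "T \<noteq> {}"
  obtains t where "t \<in> T" "m \<le> (\<Sum>i | i \<in> I \<and> g i = t. w i)"
proof -
  have "\<exists>t\<in>T. m \<le> (\<Sum>i | i \<in> I \<and> g i = t. w i)"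
  proof (rule ccontr)
    assume "\<not> ?thesis"
    then have "(\<Sum>t\<in>T. \<Sum>i | i \<in> I \<and> g i = t. w i) < (\<Sum>t\<in>T. m)"
      using T T0 by (intro sum_strict_mono) (auto simp: not_le)
    then show False using w by (simp add: sum.group[OF I T g])
  qed
  then show ?thesis using that by blast
qed

text \<open>
  The fibres of \<open>key\<close> are the cells. The remainder and the quotient of \<open>i - 1\<close> by \<open>s\<close> are the
  position of coordinate \<open>i\<close> inside its block and the number of the block, both counted from zero; the flag \<open>g1\<close> says that a cell contains whole
  blocks instead of fixing the position, and \<open>g2\<close> that it runs through all blocks instead of fixing one.
\<close>
lemma mixed_norm_cell_le_1:
  fixes g1 g2 :: bool and s b :: nat
  defines "key i \<equiv> (if g1 then 0 else (i - 1) mod s, if g2 then 0 else (i - 1) div s)"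
    and "k1 \<equiv> (if g1 then s else 1)" and "k2 \<equiv> (if g2 then b else 1)"
  assumes sb: "1 \<le> s" "1 \<le> b" and p: "1 \<le> p1" "1 \<le> p2"
    and x: "\<And>i. x i \<noteq> 0 \<Longrightarrow> key i = t"
    and bd: "\<And>i. \<bar>x i\<bar> * (real k1 powr recip p1 * real k2 powr recip p2) \<le> 1"
  shows "mixed_norm s b p1 p2 x \<le> 1"
proof -
  define blk where "blk j = {s * (j - 1)<..s * j}" for j
  define h where "h j = lp_norm p1 (blk j) x" for j
  define \<beta> where "\<beta> = real k1 powr recip p1 * real k2 powr recip p2"
  have k: "k1 \<noteq> 0" "k2 \<noteq> 0" using sb by (auto simp: k1_def k2_def)
  have \<beta>: "0 < \<beta>" using k by (simp add: \<beta>_def)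
  have xb: "\<bar>x i\<bar> \<le> 1 / \<beta>" for i
    using bd[of i] \<beta> by (simp add: \<beta>_def field_simps)
  have blk: "finite (blk j)" "card (blk j) = s" "blk j \<noteq> {}" if "j \<in> {1..b}" for j
    unfolding blk_def using block_card[OF sb(1), of j] that by auto
  have divj: "(i - 1) div s = j - 1" if "j \<in> {1..b}" "i \<in> blk j" for i j
  proof (rule div_nat_eqI)
    have "s * Suc (j - 1) = s * j" using that(1) by simp
    then show "i - 1 < s * Suc (j - 1)" using that(2) unfolding blk_def by auto
  qed (use that(2) in \<open>auto simp: blk_def\<close>)
  have h: "\<bar>h j\<bar> \<le> real k1 powr recip p1 * (1 / \<beta>)" if j: "j \<in> {1..b}" for j
  proof -
    have "card {i\<in>blk j. x i \<noteq> 0} \<le> k1"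
    proof (cases g1)
      case True
      then show ?thesis using blk[OF j] card_mono[of "blk j" "{i\<in>blk j. x i \<noteq> 0}"] by (auto simp: k1_def)
    next
      case False
      have "i = i'" if "i \<in> blk j" "x i \<noteq> 0" "i' \<in> blk j" "x i' \<noteq> 0" for i i'
      proof -
        have "(i - 1) mod s = (i' - 1) mod s"
          using x[OF that(2)] x[OF that(4)] False by (auto simp: key_def)
        then have "i - 1 = i' - 1"
          using divj[OF j that(1)] divj[OF j that(3)] by (metis div_mult_mod_eq)
        then show ?thesis using that(1,3) by (auto simp: blk_def)
      qed
      then show ?thesis
        using blk(1)[OF j] False by (auto simp: k1_def card_le_Suc0_iff_eq)
    qed
    then have "lp_norm p1 (blk j) x \<le> real k1 powr recip p1 * (1 / \<beta>)"
      using blk[OF j] p(1) xb k by (intro lp_norm_sparse_le) auto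
    then show ?thesis using lp_norm_nonneg[OF blk(1,3)[OF j]] by (simp add: h_def)
  qed
  have "card {j\<in>{1..b}. h j \<noteq> 0} \<le> k2"
  proof (cases g2)
    case True
    have "card {j\<in>{1..b}. h j \<noteq> 0} \<le> card {1..b}" by (rule card_mono) auto
    then show ?thesis using True by (simp add: k2_def)
  next
    case False
    have "{j\<in>{1..b}. h j \<noteq> 0} \<subseteq> {Suc (snd t)}"
    proof
      fix j assume "j \<in> {j\<in>{1..b}. h j \<noteq> 0}"
      then have j: "j \<in> {1..b}" "h j \<noteq> 0" by auto
      have "\<exists>i\<in>blk j. x i \<noteq> 0"
      proof (rule ccontr)
        assume "\<not> ?thesis"
        then have zero: "x i = 0" if "i \<in> blk j" for i using that by blast
        have "card {i\<in>blk j. x i \<noteq> 0} \<le> 1" using zero by (simp cong: conj_cong)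
        then have "h j \<le> real 1 powr recip p1 * 0"
          unfolding h_def using blk[OF j(1)] p(1) zero by (intro lp_norm_sparse_le) auto
        then show False using lp_norm_nonneg[OF blk(1,3)[OF j(1)], of p1 x] j(2) by (simp add: h_def)
      qed
      then obtain i where i: "i \<in> blk j" "x i \<noteq> 0" by blast
      then show "j \<in> {Suc (snd t)}"
        using x[OF i(2)] divj[OF j(1) i(1)] False j(1) by (auto simp: key_def)
    qed
    then show ?thesis using card_mono[of "{Suc (snd t)}"] False by (auto simp: k2_def)
  qed
  then have "lp_norm p2 {1..b} h \<le> real k2 powr recip p2 * (real k1 powr recip p1 * (1 / \<beta>))"
    using sb p(2) h k by (intro lp_norm_sparse_le) auto
  also have "\<dots> = 1" using k by (simp add: \<beta>_def)
  also have "lp_norm p2 {1..b} h = mixed_norm s b p1 p2 x"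
    unfolding mixed_norm_def by (rule arg_cong[where f = "lp_norm p2 {1..b}"]) (simp add: h_def blk_def fun_eq_iff)
  finally show ?thesis .
qed

section \<open>The width of mixed-norm balls\<close>
theorem mainTheorem5:
  fixes q \<epsilon> :: real
  assumes "1 \<le> q" "q \<le> 2" "0 < \<epsilon>" "\<epsilon> < 1"
  shows "\<exists>c::real. c > 0 \<and>
    (\<forall>(p1::ennreal) (p2::ennreal) (s::nat) (b::nat) (n::nat).
       1 \<le> p1 \<longrightarrow> 1 \<le> p2 \<longrightarrow> 1 \<le> s \<longrightarrow> 1 \<le> b \<longrightarrow> real n \<le> real (s * b) * (1 - \<epsilon>) \<longrightarrow>
       ennreal (c * real s powr max (1 / q - recip p1) 0 * real b powr max (1 / q - recip p2) 0)
         \<le> kolmogorov_width n (mixed_ball s b p1 p2) (coord_space (s * b))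
              (lp_norm (ennreal q) {1..s * b})
     \<and> kolmogorov_width n (mixed_ball s b p1 p2) (coord_space (s * b))
              (lp_norm (ennreal q) {1..s * b})
         \<le> ennreal (real s powr max (1 / q - recip p1) 0 * real b powr max (1 / q - recip p2) 0))"
proof -
  note q = assms(1,2) and \<epsilon> = assms(3,4)
  obtain c where c: "0 < c" "\<forall>(I :: nat set) B. finite I \<longrightarrow> finite B \<longrightarrow>
      (\<exists>w. real (card I) - real (card B) \<le> (\<Sum>i\<in>I. w i) \<and> distance_weight q c I (seq.span B) w)"
    using exists_distance_weight[OF q] by blast
  show ?thesis
  proof (rule exI[of _ "(c * \<epsilon>) powr (1 / q)"], intro conjI allI impI)
    show "0 < (c * \<epsilon>) powr (1 / q)" using c \<epsilon> by simp
    fix p1 p2 :: ennreal and s b n :: nat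
    assume p: "1 \<le> p1" "1 \<le> p2" and sb: "1 \<le> s" "1 \<le> b" and n: "real n \<le> real (s * b) * (1 - \<epsilon>)"
    show "kolmogorov_width n (mixed_ball s b p1 p2) (coord_space (s * b)) (lp_norm (ennreal q) {1..s * b})
        \<le> ennreal (real s powr max (1 / q - recip p1) 0 * real b powr max (1 / q - recip p2) 0)"
      by (rule kolmogorov_width_mixed_ball_le[OF q(1) p sb])
    let ?L = "(c * \<epsilon>) powr (1 / q) * real s powr max (1 / q - recip p1) 0 * real b powr max (1 / q - recip p2) 0"
    define g1 where "g1 \<longleftrightarrow> recip p1 < 1 / q"
    define g2 where "g2 \<longleftrightarrow> recip p2 < 1 / q"
    define key where "key i = (if g1 then 0 else (i - 1) mod s, if g2 then 0 else (i - 1) div s)" for i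
    define k1 where "k1 = (if g1 then s else 1)"
    define k2 where "k2 = (if g2 then b else 1)"
    define T where "T = {..<if g1 then 1 else s} \<times> {..<if g2 then 1 else b}"
    define \<beta> where "\<beta> = real k1 powr recip p1 * real k2 powr recip p2"
    have k0: "0 < real k1" "0 < real k2" using sb by (auto simp: k1_def k2_def)
    have \<beta>: "0 < \<beta>" using k0 by (simp add: \<beta>_def)
    have T: "finite T" "T \<noteq> {}" using sb by (auto simp: T_def lessThan_empty_iff)
    have cardT: "card T * (k1 * k2) = s * b" by (simp add: T_def k1_def k2_def)
    have keyT: "key ` {1..s * b} \<subseteq> T"
    proof
      fix t assume "t \<in> key ` {1..s * b}"
      then obtain i where i: "i \<in> {1..s * b}" "t = key i" by auto
      then have "i - 1 < b * s" by (auto simp: mult.commute)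
      then have "(i - 1) div s < b" by (rule less_mult_imp_div_less)
      then show "t \<in> T" using sb by (auto simp: i key_def T_def)
    qed
    \<comment> \<open>The positive parts come from \<open>k1\<close> and \<open>k2\<close>: when \<open>k1 = 1\<close> the exponent of \<open>s\<close> is zero.\<close>
    have L: "?L = (c * \<epsilon> * (real k1 * real k2)) powr (1 / q) / \<beta>"
    proof -
      have "real s powr max (1 / q - recip p1) 0 = real k1 powr (1 / q) / real k1 powr recip p1"
        using sb by (auto simp: k1_def g1_def max_def simp flip: powr_diff)
      moreover have "real b powr max (1 / q - recip p2) 0 = real k2 powr (1 / q) / real k2 powr recip p2"
        using sb by (auto simp: k2_def g2_def max_def simp flip: powr_diff)
      ultimately show ?thesis
        using c \<epsilon> k0 by (simp add: \<beta>_def powr_mult)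
    qed
    show "ennreal ?L \<le> kolmogorov_width n (mixed_ball s b p1 p2) (coord_space (s * b)) (lp_norm (ennreal q) {1..s * b})"
      unfolding kolmogorov_width_def
    proof (rule INF_greatest)
      fix Q assume "Q \<in> {Q. seq.subspace Q \<and> Q \<subseteq> coord_space (s * b) \<and>
          (\<exists>B. finite B \<and> Q \<subseteq> seq.span B) \<and> seq.dim Q \<le> n}"
      then obtain B' where Q: "seq.subspace Q" "seq.dim Q \<le> n" "finite B'" "Q \<subseteq> seq.span B'" by auto
      obtain B where B: "B \<subseteq> Q" "seq.independent B" "Q \<subseteq> seq.span B" "card B = seq.dim Q"
        by (rule seq.basis_exists)
      have finB: "finite B"
        using seq.independent_span_bound[OF Q(3) B(2)] B(1) Q(4) by blast
      obtain w where w: "real (card {1..s * b}) - real (card B) \<le> (\<Sum>i\<in>{1..s * b}. w i)"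
        and dist: "distance_weight q c {1..s * b} (seq.span B) w"
        using c(2) finB by blast
      have "real (card T) * (\<epsilon> * (real k1 * real k2)) = \<epsilon> * real (s * b)"
        by (simp flip: cardT)
      also have "\<dots> \<le> real (card {1..s * b}) - real (card B)"
        using n B(4) Q(2) by (simp add: algebra_simps)
      finally have "real (card T) * (\<epsilon> * (real k1 * real k2)) \<le> (\<Sum>i\<in>{1..s * b}. w i)"
        using w by linarith
      then obtain t where t: "\<epsilon> * (real k1 * real k2) \<le> (\<Sum>i | i \<in> {1..s * b} \<and> key i = t. w i)"
        by (rule exists_fibre_sum_ge[OF finite_atLeastAtMost T(1) keyT _ T(2)])
      define D where "D = {i. i \<in> {1..s * b} \<and> key i = t}"
      have "D \<subseteq> {1..s * b}" by (auto simp: D_def)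
      then obtain u where u: "\<And>i. \<bar>u i\<bar> \<le> 1" "\<And>i. i \<notin> D \<Longrightarrow> u i = 0"
        and far: "\<And>y. y \<in> seq.span B \<Longrightarrow> c * (\<Sum>i\<in>D. w i) \<le> (\<Sum>i\<in>{1..s * b}. \<bar>u i - y i\<bar> powr q)"
        using dist unfolding distance_weight_def by meson
      define x where "x i = u i / \<beta>" for i
      have "mixed_norm s b p1 p2 x \<le> 1"
      proof (rule mixed_norm_cell_le_1[where ?g1.0 = g1 and ?g2.0 = g2 and t = t, OF sb p])
        show "(if g1 then 0 else (i - 1) mod s, if g2 then 0 else (i - 1) div s) = t" if "x i \<noteq> 0" for i
        proof -
          have "i \<in> D" using u(2)[of i] that by (auto simp: x_def)
          then show ?thesis by (simp add: D_def key_def)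
        qed
        show "\<bar>x i\<bar> * (real (if g1 then s else 1) powr recip p1 * real (if g2 then b else 1) powr recip p2) \<le> 1" for i
          using u(1)[of i] \<beta> unfolding k1_def[symmetric] k2_def[symmetric] \<beta>_def[symmetric] by (simp add: x_def)
      qed
      moreover have "x \<in> coord_space (s * b)"
        using u(2) by (auto simp: coord_space_def x_def D_def)
      ultimately have xK: "x \<in> mixed_ball s b p1 p2" by (simp add: mixed_ball_def)
      have "ennreal ?L \<le> (INF y\<in>Q. ennreal (lp_norm (ennreal q) {1..s * b} (x - y)))"
      proof (intro INF_greatest ennreal_leI)
        fix y assume "y \<in> Q"
        then have y: "scale_seq \<beta> y \<in> seq.span B"
          using B(3) by (intro seq.span_scale) blast
        have "c * \<epsilon> * (real k1 * real k2) \<le> c * (\<Sum>i\<in>D. w i)"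
          using t c(1) by (simp add: D_def mult.assoc)
        also have "\<dots> \<le> (\<Sum>i\<in>{1..s * b}. \<bar>u i - \<beta> * y i\<bar> powr q)"
          using far[OF y] by (simp add: scale_seq_def)
        also have "\<dots> = (\<Sum>i\<in>{1..s * b}. \<beta> powr q * \<bar>x i - y i\<bar> powr q)"
        proof (intro sum.cong refl)
          fix i
          have "u i - \<beta> * y i = \<beta> * (x i - y i)" using \<beta> by (simp add: x_def algebra_simps)
          then show "\<bar>u i - \<beta> * y i\<bar> powr q = \<beta> powr q * \<bar>x i - y i\<bar> powr q"
            using \<beta> by (simp add: abs_mult powr_mult)
        qed
        finally have "(c * \<epsilon> * (real k1 * real k2)) powr (1 / q)
            \<le> (\<beta> powr q * (\<Sum>i\<in>{1..s * b}. \<bar>x i - y i\<bar> powr q)) powr (1 / q)"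
          using q c \<epsilon> by (intro powr_mono2) (auto simp: sum_distrib_left)
        also have "\<dots> = \<beta> * lp_norm (ennreal q) {1..s * b} (x - y)"
          using q \<beta> by (simp add: lp_norm_ennreal powr_mult powr_powr sum_nonneg)
        finally show "?L \<le> lp_norm (ennreal q) {1..s * b} (x - y)"
          unfolding L using \<beta> by (simp add: divide_le_eq mult.commute)
      qed
      also have "\<dots> \<le> (SUP x\<in>mixed_ball s b p1 p2. INF y\<in>Q. ennreal (lp_norm (ennreal q) {1..s * b} (x - y)))"
        using xK by (rule SUP_upper)
      finally show "ennreal ?L
        \<le> (SUP x\<in>mixed_ball s b p1 p2. INF y\<in>Q. ennreal (lp_norm (ennreal q) {1..s * b} (x - y)))" .
    qed
  qed
qed

end
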